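(* For every $k\ge 1$, the cactus group $J_{2^k}$ contains an element of order $2^k$.
   Context: For $n \ge 2$, the cactus group $J_n$ is the group with generators $s_{p,q}$ for $1 \le p < q \le n$ and relations: (j1) $s_{p,q}^2 = 1$; (j2) $s_{p,q}s_{m,r} = s_{m,r}s_{p,q}$ whenever $[p,q]\cap[m,r]=\emptyset$; (j3) $s_{p,q}s_{m,r} = s_{p+q-r,\,p+q-m}\,s_{p,q}$ whenever $[m,r]\subset[p,q]$ (intervals of integers). *)

theory Defs
  imports "HOL-Algebra.Multiplicative_Group"
begin

text \<open>A letter \<open>(x, True)\<close> stands for the generator \<open>x\<close>, and \<open>(x, False)\<close> for its formal inverse.
  A relation \<open>u = v\<close> is the pair of words \<open>(u, v)\<close>.\<close>

type_synonym 'a pres_word = "('a \<times> bool) list"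

definition pres_words :: "'a set \<Rightarrow> 'a pres_word set" where
  "pres_words S = lists (S \<times> UNIV)"

inductive pres_eq :: "'a set \<Rightarrow> ('a pres_word \<times> 'a pres_word) set \<Rightarrow> 'a pres_word \<Rightarrow> 'a pres_word \<Rightarrow> bool"
  for S :: "'a set" and R :: "('a pres_word \<times> 'a pres_word) set" where
  pres_refl: "w \<in> pres_words S \<Longrightarrow> pres_eq S R w w"
| pres_sym: "pres_eq S R u v \<Longrightarrow> pres_eq S R v u"
| pres_trans: "pres_eq S R u v \<Longrightarrow> pres_eq S R v w \<Longrightarrow> pres_eq S R u w"
| pres_cancel: "x \<in> S \<Longrightarrow> a \<in> pres_words S \<Longrightarrow> b \<in> pres_words S \<Longrightarrow>
    pres_eq S R (a @ [(x, e), (x, \<not> e)] @ b) (a @ b)"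
| pres_rel: "(u, v) \<in> R \<Longrightarrow> u \<in> pres_words S \<Longrightarrow> v \<in> pres_words S \<Longrightarrow>
    a \<in> pres_words S \<Longrightarrow> b \<in> pres_words S \<Longrightarrow> pres_eq S R (a @ u @ b) (a @ v @ b)"

definition pres_eq_rel :: "'a set \<Rightarrow> ('a pres_word \<times> 'a pres_word) set \<Rightarrow> ('a pres_word \<times> 'a pres_word) set" where
  "pres_eq_rel S R = {(u, v). pres_eq S R u v}"

definition presented_group ::
    "'a set \<Rightarrow> ('a pres_word \<times> 'a pres_word) set \<Rightarrow> 'a pres_word set monoid" where
  "presented_group S R =
     \<lparr>carrier = pres_words S // pres_eq_rel S R,
      mult = (\<lambda>A B. \<Union>a\<in>A. \<Union>b\<in>B. pres_eq_rel S R `` {a @ b}),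
      one = pres_eq_rel S R `` {[]}\<rparr>"

lemma pres_words_Nil [simp]: "[] \<in> pres_words S"
  by (simp add: pres_words_def)

lemma pres_words_append [simp]:
  "u @ v \<in> pres_words S \<longleftrightarrow> u \<in> pres_words S \<and> v \<in> pres_words S"
  by (auto simp: pres_words_def)

lemma pres_words_Cons [simp]:
  "(x, e) # v \<in> pres_words S \<longleftrightarrow> x \<in> S \<and> v \<in> pres_words S"
  by (auto simp: pres_words_def)

lemma pres_eq_words:
  assumes "pres_eq S R u v"
  shows "u \<in> pres_words S" "v \<in> pres_words S"
  using assms by (induction) auto

lemma equiv_pres_eq_rel: "equiv (pres_words S) (pres_eq_rel S R)"
proof (rule equivI)
  show "pres_eq_rel S R \<subseteq> pres_words S \<times> pres_words S"
    by (auto simp: pres_eq_rel_def dest: pres_eq_words)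
  show "refl_on (pres_words S) (pres_eq_rel S R)"
    by (auto simp: refl_on_def pres_eq_rel_def intro: pres_refl dest: pres_eq_words)
  show "sym (pres_eq_rel S R)"
    by (auto simp: sym_def pres_eq_rel_def intro: pres_sym)
  show "trans (pres_eq_rel S R)"
    by (auto simp: trans_def pres_eq_rel_def intro: pres_trans)
qed

lemma pres_eq_context:
  assumes "pres_eq S R u v" "c \<in> pres_words S" "d \<in> pres_words S"
  shows "pres_eq S R (c @ u @ d) (c @ v @ d)"
  using assms
proof (induction)
  case (pres_refl w)
  then show ?case by (intro pres_eq.pres_refl) auto
next
  case (pres_sym u v)
  then show ?case by (auto intro: pres_eq.pres_sym)
next
  case (pres_trans u v w)
  then show ?case by (meson pres_eq.pres_trans)
next
  case (pres_cancel x a b e)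
  then show ?case using pres_eq.pres_cancel[of x S "c @ a" "b @ d" R e] by simp
next
  case (pres_rel u v a b)
  then show ?case using pres_eq.pres_rel[of u v R S "c @ a" "b @ d"] by simp
qed

lemma pres_eq_append:
  assumes "pres_eq S R u u'" "pres_eq S R v v'"
  shows "pres_eq S R (u @ v) (u' @ v')"
proof -
  have "pres_eq S R (u @ v) (u' @ v)"
    using pres_eq_context[OF assms(1), of "[]" v] pres_eq_words[OF assms(2)] by simp
  moreover have "pres_eq S R (u' @ v) (u' @ v')"
    using pres_eq_context[OF assms(2), of u' "[]"] pres_eq_words[OF assms(1)] by simp
  ultimately show ?thesis by (rule pres_trans)
qed

lemma presented_group_mult:
  assumes "u \<in> pres_words S" "v \<in> pres_words S"
  shows "(pres_eq_rel S R `` {u}) \<otimes>\<^bsub>presented_group S R\<^esub> (pres_eq_rel S R `` {v})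
         = pres_eq_rel S R `` {u @ v}"
proof -
  have "congruent2 (pres_eq_rel S R) (pres_eq_rel S R) (\<lambda>a b. pres_eq_rel S R `` {a @ b})"
    by (auto simp: congruent2_def pres_eq_rel_def) (meson pres_eq_append pres_sym pres_trans)+
  from UN_equiv_class2[OF equiv_pres_eq_rel equiv_pres_eq_rel this assms]
  show ?thesis by (simp add: presented_group_def)
qed

lemma presented_group_carrier:
  "carrier (presented_group S R) = (\<lambda>u. pres_eq_rel S R `` {u}) ` pres_words S"
  by (auto simp: presented_group_def quotient_def)

lemma presented_group_one: "\<one>\<^bsub>presented_group S R\<^esub> = pres_eq_rel S R `` {[]}"
  by (simp add: presented_group_def)

lemma pres_eq_left_inverse:
  assumes "w \<in> pres_words S"
  shows "\<exists>v\<in>pres_words S. pres_eq S R (v @ w) []"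
  using assms
proof (induction w)
  case Nil
  show ?case by (intro bexI[of _ "[]"]) (auto intro: pres_refl)
next
  case (Cons l w)
  obtain x e where l: "l = (x, e)" by (cases l)
  with Cons obtain v where v: "v \<in> pres_words S" "pres_eq S R (v @ w) []" and x: "x \<in> S" "w \<in> pres_words S"
    by auto
  have "pres_eq S R ((v @ [(x, \<not> e)]) @ l # w) (v @ w)"
    using pres_cancel[OF x(1) v(1) x(2), of R "\<not> e"] l by simp
  then have "pres_eq S R ((v @ [(x, \<not> e)]) @ l # w) []" using v(2) by (rule pres_trans)
  moreover have "v @ [(x, \<not> e)] \<in> pres_words S" using v x by simp
  ultimately show ?case by blast
qed

lemma group_presented_group: "group (presented_group S R)"
proof (rule groupI)
  fix A assume "A \<in> carrier (presented_group S R)"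
  then obtain w where w: "w \<in> pres_words S" "A = pres_eq_rel S R `` {w}"
    by (auto simp: presented_group_carrier)
  then obtain v where v: "v \<in> pres_words S" "pres_eq S R (v @ w) []"
    using pres_eq_left_inverse by blast
  then have "pres_eq_rel S R `` {v @ w} = pres_eq_rel S R `` {[]}"
    using equiv_class_eq[OF equiv_pres_eq_rel] by (force simp: pres_eq_rel_def)
  with v w show "\<exists>B\<in>carrier (presented_group S R). B \<otimes>\<^bsub>presented_group S R\<^esub> A = \<one>\<^bsub>presented_group S R\<^esub>"
    by (auto simp: presented_group_carrier presented_group_one presented_group_mult)
qed (auto simp: presented_group_carrier presented_group_one presented_group_mult)

text \<open>The pair \<open>(p, q)\<close> is the generator \<open>s\<^sub>p\<^sub>,\<^sub>q\<close>. In the third family of relations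
  \<open>m < r \<le> q\<close>, so the natural-number subtractions do not truncate.\<close>

definition cactus_gens :: "nat \<Rightarrow> (nat \<times> nat) set" where
  "cactus_gens n = {(p, q). 1 \<le> p \<and> p < q \<and> q \<le> n}"

abbreviation cactus_s :: "nat \<Rightarrow> nat \<Rightarrow> (nat \<times> nat) \<times> bool" where
  "cactus_s p q \<equiv> ((p, q), True)"

definition cactus_rels :: "nat \<Rightarrow> ((nat \<times> nat) pres_word \<times> (nat \<times> nat) pres_word) set" where
  "cactus_rels n =
     {([cactus_s p q, cactus_s p q], []) | p q. (p, q) \<in> cactus_gens n}
   \<union> {([cactus_s p q, cactus_s m r], [cactus_s m r, cactus_s p q]) | p q m r.
        (p, q) \<in> cactus_gens n \<and> (m, r) \<in> cactus_gens n \<and> {p..q} \<inter> {m..r} = {}}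
   \<union> {([cactus_s p q, cactus_s m r], [cactus_s (p + q - r) (p + q - m), cactus_s p q]) | p q m r.
        (p, q) \<in> cactus_gens n \<and> (m, r) \<in> cactus_gens n \<and> {m..r} \<subseteq> {p..q}}"

definition cactus_group :: "nat \<Rightarrow> (nat \<times> nat) pres_word set monoid" where
  "cactus_group n = presented_group (cactus_gens n) (cactus_rels n)"

lemma group_cactus_group: "group (cactus_group n)"
  unfolding cactus_group_def by (rule group_presented_group)

text \<open>Every relation is a pair of words in the generators, so none is discarded by the side
  conditions of \<open>pres_rel\<close>.\<close>

lemma cactus_rels_words: "cactus_rels n \<subseteq> pres_words (cactus_gens n) \<times> pres_words (cactus_gens n)"
  by (auto simp: cactus_rels_def cactus_gens_def)

end

theory Submission
  imports Defs "HOL-Computational_Algebra.Primes"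
begin

text \<open>The witness is \<open>x\<^sub>k = s\<^sub>1\<^sub>,\<^sub>N s\<^sub>1\<^sub>,\<^sub>N\<^sub>/\<^sub>2 \<dots> s\<^sub>1\<^sub>,\<^sub>2\<close> with \<open>N = 2 ^ k\<close>.
  Writing \<open>h = s\<^sub>1\<^sub>,\<^sub>2\<^sub>N\<close>, one has \<open>x\<^bsub>k+1\<^esub>\<^sup>2 = (h x\<^sub>k h) x\<^sub>k\<close>, where \<open>x\<^sub>k\<close> is supported
  on the left half of \<open>[1, 2N]\<close> and its mirror image \<open>h x\<^sub>k h\<close> on the right half. The two factors
  commute and have the same order, so \<open>x\<^sub>k\<close> has order dividing \<open>2 ^ k\<close> by induction.
  For the lower bound, let \<open>s\<^sub>p\<^sub>,\<^sub>q\<close> act on the integers by reversing \<open>[p, q]\<close>: then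
  \<open>x\<^bsub>k+1\<^esub>\<^sup>2\<close> acts on the left half as \<open>x\<^sub>k\<close> does, and so \<open>x\<^sub>k\<close> raised to the power
  \<open>2 ^ (k - 1)\<close> moves the point \<open>1\<close>.\<close>

section \<open>The action by interval reversals\<close>

definition interval_rev :: "nat \<times> nat \<Rightarrow> nat \<Rightarrow> nat" where
  "interval_rev = (\<lambda>(p, q) i. if p \<le> i \<and> i \<le> q then p + q - i else i)"

text \<open>The sign of a letter is dropped: each reversal is its own inverse, so a generator and
  its formal inverse act alike. The head letter acts last.\<close>

fun cactus_act :: "(nat \<times> nat) pres_word \<Rightarrow> nat \<Rightarrow> nat" where
  "cactus_act [] = id"
| "cactus_act (l # w) = interval_rev (fst l) \<circ> cactus_act w"

lemma cactus_act_append: "cactus_act (u @ v) = cactus_act u \<circ> cactus_act v"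
  by (induction u) (auto simp: fun_eq_iff)

lemma interval_rev_involution: "interval_rev x \<circ> interval_rev x = id"
  by (cases x) (auto simp: interval_rev_def fun_eq_iff)

lemma interval_rev_commute:
  assumes "{p..q} \<inter> {m..r} = {}" "p < q" "m < r"
  shows "interval_rev (p, q) \<circ> interval_rev (m, r) = interval_rev (m, r) \<circ> interval_rev (p, q)"
proof -
  have "q < m \<or> r < p"
    using assms by (auto simp: disjoint_iff)
  then show ?thesis
    using assms(2,3) by (auto simp: interval_rev_def fun_eq_iff)
qed

lemma interval_rev_conjugate:
  assumes "{m..r} \<subseteq> {p..q}" "m < r"
  shows "interval_rev (p, q) \<circ> interval_rev (m, r) =
    interval_rev (p + q - r, p + q - m) \<circ> interval_rev (p, q)"
proof -
  have "p \<le> m" "r \<le> q" using assms by auto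
  then show ?thesis
    using assms(2) by (auto simp: interval_rev_def fun_eq_iff)
qed

text \<open>Reversals satisfy all three families of relations, so the action descends to the cactus
  group and can certify that an element is nontrivial.\<close>

lemma cactus_act_eq:
  assumes "pres_eq (cactus_gens n) (cactus_rels n) u v"
  shows "cactus_act u = cactus_act v"
  using assms
proof induction
  case (pres_cancel x a b e)
  have "cactus_act [(x, e), (x, \<not> e)] = id"
    by (simp add: interval_rev_involution)
  then show ?case by (simp only: cactus_act_append id_comp)
next
  case (pres_rel u v a b)
  then have "cactus_act u = cactus_act v"
    unfolding cactus_rels_def cactus_gens_def
    by (auto simp: interval_rev_involution interval_rev_commute interval_rev_conjugate)
  then show ?case by (simp add: cactus_act_append)
qed auto

section \<open>The witness word and how it moves points\<close>

fun cactus_witness :: "nat \<Rightarrow> (nat \<times> nat) pres_word" where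
  "cactus_witness 0 = []"
| "cactus_witness (Suc k) = cactus_s 1 (2 ^ Suc k) # cactus_witness k"

text \<open>The two claims go through one induction: to see that the doubled interval is preserved,
  one must know that the shorter word fixes its right half.\<close>

lemma cactus_witness_act_range:
  "cactus_act (cactus_witness k) i \<in> {1..2 ^ k} \<longleftrightarrow> i \<in> {1..2 ^ k}"
  "i \<notin> {1..2 ^ k} \<Longrightarrow> cactus_act (cactus_witness k) i = i"
proof (induction k arbitrary: i)
  case (Suc k)
  have out: "cactus_act (cactus_witness (Suc k)) i = i" if "i \<notin> {1..2 ^ Suc k}" for i
    using that Suc(2)[of i] by (auto simp: interval_rev_def)
  have inn: "cactus_act (cactus_witness (Suc k)) i \<in> {1..2 ^ Suc k}" if "i \<in> {1..2 ^ Suc k}" for i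
  proof -
    have "cactus_act (cactus_witness k) i \<in> {1..2 ^ Suc k}"
      using that Suc(1)[of i] Suc(2)[of i] by (cases "i \<in> {1..2 ^ k}") auto
    then show ?thesis by (auto simp: interval_rev_def)
  qed
  { case 1 show ?case using out[of i] inn[of i] by metis }
  { case 2 then show ?case by (rule out) }
qed auto

text \<open>The first application lands in the right half, at the mirror image of the point reached
  by \<open>cactus_witness k\<close>. That word fixes the right half, so the second application
  merely reflects back.\<close>

lemma cactus_witness_act_square:
  assumes "i \<in> {1..2 ^ k}"
  shows "cactus_act (cactus_witness (Suc k)) (cactus_act (cactus_witness (Suc k)) i) =
    cactus_act (cactus_witness k) i"
proof -
  let ?g = "cactus_act (cactus_witness k)"
  have g: "1 \<le> ?g i" "?g i \<le> 2 ^ k"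
    using assms cactus_witness_act_range(1)[of k i] by auto
  have s: "cactus_act (cactus_witness (Suc k)) i = 2 * 2 ^ k + 1 - ?g i"
    using g by (simp add: interval_rev_def)
  have "?g (2 * 2 ^ k + 1 - ?g i) = 2 * 2 ^ k + 1 - ?g i"
    by (rule cactus_witness_act_range(2)) (use g in auto)
  then show ?thesis
    unfolding s using g
    by (simp add: interval_rev_def) linarith
qed

text \<open>The second conjunct keeps the iterates in the left half, where the squaring identity
  applies again.\<close>

lemma cactus_witness_act_power_double:
  assumes "i \<in> {1..2 ^ k}"
  shows "(cactus_act (cactus_witness (Suc k)) ^^ (2 * m)) i = (cactus_act (cactus_witness k) ^^ m) i
    \<and> (cactus_act (cactus_witness k) ^^ m) i \<in> {1..2 ^ k}"
proof (induction m)
  case (Suc m)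
  then show ?case
    using cactus_witness_act_square[of "(cactus_act (cactus_witness k) ^^ m) i" k]
      cactus_witness_act_range(1)[of k "(cactus_act (cactus_witness k) ^^ m) i"]
    by (simp del: cactus_witness.simps)
qed (use assms in auto)

text \<open>Each squaring descends one level and halves the exponent, down to
  \<open>cactus_s 1 2\<close>, which sends 1 to 2.\<close>

lemma cactus_witness_act_power_ne:
  "(cactus_act (cactus_witness (Suc k)) ^^ (2 ^ k)) 1 \<noteq> 1"
proof (induction k)
  case (Suc k)
  then show ?case
    using cactus_witness_act_power_double[of 1 "Suc k" "2 ^ k"]
    by (simp del: cactus_witness.simps)
qed (simp add: interval_rev_def)

section \<open>Classes of words in the cactus group\<close>

abbreviation cactus_class :: "nat \<Rightarrow> (nat \<times> nat) pres_word \<Rightarrow> (nat \<times> nat) pres_word set" where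
  "cactus_class n w \<equiv> pres_eq_rel (cactus_gens n) (cactus_rels n) `` {w}"

lemma cactus_class_carrier:
  "w \<in> pres_words (cactus_gens n) \<Longrightarrow> cactus_class n w \<in> carrier (cactus_group n)"
  by (simp add: cactus_group_def presented_group_carrier)

lemma cactus_class_mult:
  "\<lbrakk>u \<in> pres_words (cactus_gens n); v \<in> pres_words (cactus_gens n)\<rbrakk> \<Longrightarrow>
    cactus_class n u \<otimes>\<^bsub>cactus_group n\<^esub> cactus_class n v = cactus_class n (u @ v)"
  by (simp add: cactus_group_def presented_group_mult)

lemma cactus_class_one: "\<one>\<^bsub>cactus_group n\<^esub> = cactus_class n []"
  by (simp add: cactus_group_def presented_group_one)

lemma cactus_class_rel:
  assumes "(u, v) \<in> cactus_rels n"
  shows "cactus_class n u = cactus_class n v"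
proof -
  have "u \<in> pres_words (cactus_gens n)" "v \<in> pres_words (cactus_gens n)"
    using assms cactus_rels_words by auto
  then have "pres_eq (cactus_gens n) (cactus_rels n) u v"
    using pres_rel[OF assms, of "cactus_gens n" "[]" "[]"] by simp
  then show ?thesis
    by (intro equiv_class_eq[OF equiv_pres_eq_rel]) (simp add: pres_eq_rel_def)
qed

text \<open>This carries the lower bound from the action to the group: equal classes act
  equally.\<close>

lemma cactus_class_pow_act:
  assumes "w \<in> pres_words (cactus_gens n)"
    and "cactus_class n w [^]\<^bsub>cactus_group n\<^esub> m = \<one>\<^bsub>cactus_group n\<^esub>"
  shows "cactus_act w ^^ m = id"
proof -
  interpret group "cactus_group n" by (rule group_cactus_group)
  \<comment> \<open>The power is the class of the repeated word; membership in
    \<open>pres_words\<close> is carried along because \<open>cactus_class_mult\<close> asks for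
    it.\<close>
  have pow: "concat (replicate m w) \<in> pres_words (cactus_gens n) \<and>
    cactus_class n w [^]\<^bsub>cactus_group n\<^esub> m = cactus_class n (concat (replicate m w))" for m :: nat
  proof (induction m)
    case (Suc m)
    then show ?case
      using assms(1) nat_pow_Suc2[OF cactus_class_carrier[OF assms(1)], of m]
      by (simp add: cactus_class_mult del: nat_pow_Suc)
  qed (simp add: cactus_class_one)
  have "cactus_class n (concat (replicate m w)) = cactus_class n []"
    using pow[of m] assms(2) by (simp add: cactus_class_one)
  then have "pres_eq (cactus_gens n) (cactus_rels n) (concat (replicate m w)) []"
    using eq_equiv_class[OF _ equiv_pres_eq_rel] by (force simp: pres_eq_rel_def)
  then have "cactus_act (concat (replicate m w)) = id"
    by (simp add: cactus_act_eq)
  moreover have "cactus_act (concat (replicate m w)) = cactus_act w ^^ m" for m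
    by (induction m) (auto simp: cactus_act_append)
  ultimately show ?thesis by simp
qed

lemma cactus_gens_power: "\<lbrakk>1 \<le> j; j \<le> k; 2 ^ k \<le> n\<rbrakk> \<Longrightarrow> (1, 2 ^ j) \<in> cactus_gens n"
  using order_trans[OF power_increasing[of j k "2::nat"]] power_increasing[of 1 j "2::nat"]
  by (auto simp: cactus_gens_def)

lemma cactus_witness_words:
  "2 ^ k \<le> n \<Longrightarrow> cactus_witness k \<in> pres_words (cactus_gens n)"
proof (induction k)
  case (Suc k)
  then show ?case using cactus_gens_power[of "Suc k" "Suc k" n] by simp
qed simp

section \<open>Conjugation by an involution and the upper bound\<close>

lemma (in group) commute_mult:
  "\<lbrakk>x \<in> carrier G; y \<in> carrier G; z \<in> carrier G; z \<otimes> x = x \<otimes> z; z \<otimes> y = y \<otimes> z\<rbrakk> \<Longrightarrow>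
    z \<otimes> (x \<otimes> y) = (x \<otimes> y) \<otimes> z"
  by (metis m_assoc m_closed)

lemma (in group) involution_conjugate_mult:
  assumes "h \<in> carrier G" "h \<otimes> h = \<one>" "x \<in> carrier G" "y \<in> carrier G"
  shows "h \<otimes> (x \<otimes> y) \<otimes> h = (h \<otimes> x \<otimes> h) \<otimes> (h \<otimes> y \<otimes> h)"
proof -
  have "(h \<otimes> x \<otimes> h) \<otimes> (h \<otimes> y \<otimes> h) = h \<otimes> x \<otimes> (h \<otimes> h) \<otimes> (y \<otimes> h)"
    using assms(1,3,4) by (simp only: m_assoc m_closed)
  then show ?thesis using assms by (simp add: m_assoc)
qed

lemma (in group) involution_conjugate_pow:
  assumes "h \<in> carrier G" "h \<otimes> h = \<one>" "x \<in> carrier G"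
  shows "(h \<otimes> x \<otimes> h) [^] (m::nat) = h \<otimes> x [^] m \<otimes> h"
proof (induction m)
  case (Suc m)
  then show ?case using assms by (simp add: involution_conjugate_mult)
qed (use assms in simp)

text \<open>The square of \<open>h \<otimes> x\<close> is a product of two commuting factors, so its
  \<open>m\<close>-th power splits; conjugation by \<open>h\<close> takes the trivial power of
  \<open>x\<close> to a trivial power.\<close>

lemma (in group) pow_double_of_involution:
  assumes h: "h \<in> carrier G" "h \<otimes> h = \<one>" and x: "x \<in> carrier G"
    and comm: "(h \<otimes> x \<otimes> h) \<otimes> x = x \<otimes> (h \<otimes> x \<otimes> h)"
    and pow: "x [^] (m::nat) = \<one>"
  shows "(h \<otimes> x) [^] (2 * m) = \<one>"
proof -
  have "(h \<otimes> x) [^] (2 * m) = ((h \<otimes> x) [^] (2::nat)) [^] m"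
    using h x by (simp add: nat_pow_pow)
  also have "(h \<otimes> x) [^] (2::nat) = (h \<otimes> x \<otimes> h) \<otimes> x"
    using h x by (simp add: numeral_2_eq_2 m_assoc)
  also have "\<dots> [^] m = (h \<otimes> x \<otimes> h) [^] m \<otimes> x [^] m"
    using h x comm by (intro pow_mult_distrib) auto
  finally show ?thesis
    using h x pow by (simp add: involution_conjugate_pow)
qed

text \<open>Commutation is established first between single letters and mirrored letters, then
  extended to words in one factor at a time.\<close>

lemma cactus_witness_mirror_commute:
  fixes k n :: nat
  defines "G \<equiv> cactus_group n"
  defines "h \<equiv> cactus_class n [cactus_s 1 (2 ^ Suc k)]"
  assumes n: "2 ^ Suc k \<le> n"
  shows "(h \<otimes>\<^bsub>G\<^esub> cactus_class n (cactus_witness k) \<otimes>\<^bsub>G\<^esub> h) \<otimes>\<^bsub>G\<^esub> cactus_class n (cactus_witness k) =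
    cactus_class n (cactus_witness k) \<otimes>\<^bsub>G\<^esub> (h \<otimes>\<^bsub>G\<^esub> cactus_class n (cactus_witness k) \<otimes>\<^bsub>G\<^esub> h)"
    and "h \<otimes>\<^bsub>G\<^esub> h = \<one>\<^bsub>G\<^esub>" and "h \<in> carrier G"
proof -
  interpret group G unfolding G_def by (rule group_cactus_group)
  let ?N = "2 ^ Suc k :: nat"
  let ?c = "\<lambda>p q. cactus_class n [cactus_s p q]"
  let ?x = "\<lambda>j. cactus_class n (cactus_witness j)"
  have gN: "(1, ?N) \<in> cactus_gens n"
    using cactus_gens_power[of "Suc k" "Suc k" n] n by simp
  have c: "?c p q \<in> carrier G" if "(p, q) \<in> cactus_gens n" for p q
    unfolding G_def by (rule cactus_class_carrier) (use that in simp)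
  show h: "h \<in> carrier G" unfolding h_def by (rule c[OF gN])
  have "([cactus_s 1 ?N, cactus_s 1 ?N], []) \<in> cactus_rels n"
    using gN unfolding cactus_rels_def by blast
  from cactus_class_rel[OF this] show hh: "h \<otimes>\<^bsub>G\<^esub> h = \<one>\<^bsub>G\<^esub>"
    using gN by (simp add: h_def G_def cactus_class_mult cactus_class_one)
  have g: "(1, 2 ^ Suc j) \<in> cactus_gens n" "2 ^ Suc j \<le> (2::nat) ^ k"
    "?x j \<in> carrier G" "?x (Suc j) = ?c 1 (2 ^ Suc j) \<otimes>\<^bsub>G\<^esub> ?x j" if "j < k" for j
  proof -
    show g: "(1, 2 ^ Suc j) \<in> cactus_gens n"
      using cactus_gens_power[of "Suc j" "Suc k" n] n that by simp
    show "2 ^ Suc j \<le> (2::nat) ^ k" using that by (intro power_increasing) auto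
    have "2 ^ j \<le> (2::nat) ^ Suc k" using that by (intro power_increasing) auto
    then have w: "cactus_witness j \<in> pres_words (cactus_gens n)"
      using cactus_witness_words[of j n] n by linarith
    then show "?x j \<in> carrier G" unfolding G_def by (rule cactus_class_carrier)
    show "?x (Suc j) = ?c 1 (2 ^ Suc j) \<otimes>\<^bsub>G\<^esub> ?x j"
      using g w by (simp add: G_def cactus_class_mult)
  qed
  have xk: "?x k \<in> carrier G"
    unfolding G_def using n by (intro cactus_class_carrier cactus_witness_words) simp
  have x0: "?x 0 = \<one>\<^bsub>G\<^esub>" by (simp add: G_def cactus_class_one)
  \<comment> \<open>Letter against mirrored letter: (j3) computes the mirror image, and (j2) applies
    because the two intervals lie in opposite halves.\<close>
  have comm1: "?c 1 (2 ^ Suc i) \<otimes>\<^bsub>G\<^esub> (h \<otimes>\<^bsub>G\<^esub> ?c 1 (2 ^ Suc j) \<otimes>\<^bsub>G\<^esub> h) =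
      (h \<otimes>\<^bsub>G\<^esub> ?c 1 (2 ^ Suc j) \<otimes>\<^bsub>G\<^esub> h) \<otimes>\<^bsub>G\<^esub> ?c 1 (2 ^ Suc i)" if i: "i < k" and j: "j < k" for i j
  proof -
    \<comment> \<open>Reflecting \<open>{1..2 ^ Suc j}\<close> in \<open>{1..?N}\<close> gives
      \<open>{?p..?N}\<close>; as \<open>2 ^ Suc j \<le> 2 ^ k\<close>, it starts strictly beyond
      the left half.\<close>
    let ?p = "1 + ?N - 2 ^ Suc j"
    have "(2::nat) \<le> 2 ^ Suc j" by simp
    then have p: "?p > 2 ^ k" "?p < ?N"
      using g(2)[OF j] power_Suc[of "2::nat" k] by linarith+
    then have gp: "(?p, ?N) \<in> cactus_gens n" using n by (auto simp: cactus_gens_def)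
    have "{1..2 ^ Suc j} \<subseteq> {1..?N}" using j by auto
    then have "([cactus_s 1 ?N, cactus_s 1 (2 ^ Suc j)],
        [cactus_s ?p (1 + ?N - 1), cactus_s 1 ?N]) \<in> cactus_rels n"
      using gN g(1)[OF j] unfolding cactus_rels_def by blast
    from cactus_class_rel[OF this]
    have "h \<otimes>\<^bsub>G\<^esub> ?c 1 (2 ^ Suc j) = ?c ?p ?N \<otimes>\<^bsub>G\<^esub> h"
      using gN g(1)[OF j] gp by (simp add: h_def G_def cactus_class_mult)
    then have mirror: "h \<otimes>\<^bsub>G\<^esub> ?c 1 (2 ^ Suc j) \<otimes>\<^bsub>G\<^esub> h = ?c ?p ?N"
      using h hh c[OF gp] by (simp add: m_assoc)
    have "{1..2 ^ Suc i} \<inter> {?p..?N} = {}" using p(1) g(2)[OF i] by auto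
    then have "([cactus_s 1 (2 ^ Suc i), cactus_s ?p ?N],
        [cactus_s ?p ?N, cactus_s 1 (2 ^ Suc i)]) \<in> cactus_rels n"
      using gp g(1)[OF i] unfolding cactus_rels_def by blast
    from cactus_class_rel[OF this] show ?thesis
      unfolding mirror using gp g(1)[OF i] by (simp add: G_def cactus_class_mult)
  qed
  \<comment> \<open>Conjugation by \<open>h\<close> is multiplicative, so the mirrored letter can be
    replaced by a mirrored word.\<close>
  have comm2: "?c 1 (2 ^ Suc i) \<otimes>\<^bsub>G\<^esub> (h \<otimes>\<^bsub>G\<^esub> ?x j \<otimes>\<^bsub>G\<^esub> h) =
      (h \<otimes>\<^bsub>G\<^esub> ?x j \<otimes>\<^bsub>G\<^esub> h) \<otimes>\<^bsub>G\<^esub> ?c 1 (2 ^ Suc i)" if i: "i < k" and "j \<le> k" for i j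
    using \<open>j \<le> k\<close>
  proof (induction j)
    case 0
    then show ?case unfolding x0 using h hh c[OF g(1)[OF i]] by simp
  next
    case (Suc j)
    then have j: "j < k" by simp
    show ?case
      unfolding g(4)[OF j] involution_conjugate_mult[OF h hh c[OF g(1)[OF j]] g(3)[OF j]]
      by (rule commute_mult)
        (use Suc j h c[OF g(1)[OF i]] c[OF g(1)[OF j]] g(3)[OF j] comm1[OF i j] in simp_all)
  qed
  have "(h \<otimes>\<^bsub>G\<^esub> ?x k \<otimes>\<^bsub>G\<^esub> h) \<otimes>\<^bsub>G\<^esub> ?x i = ?x i \<otimes>\<^bsub>G\<^esub> (h \<otimes>\<^bsub>G\<^esub> ?x k \<otimes>\<^bsub>G\<^esub> h)" if "i \<le> k" for i
    using that
  proof (induction i)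
    case 0
    then show ?case unfolding x0 using h xk by simp
  next
    case (Suc i)
    then have i: "i < k" by simp
    show ?case
      unfolding g(4)[OF i]
      by (rule commute_mult)
        (use Suc i h xk c[OF g(1)[OF i]] g(3)[OF i] comm2[OF i, of k] in simp_all)
  qed
  then show "(h \<otimes>\<^bsub>G\<^esub> ?x k \<otimes>\<^bsub>G\<^esub> h) \<otimes>\<^bsub>G\<^esub> ?x k = ?x k \<otimes>\<^bsub>G\<^esub> (h \<otimes>\<^bsub>G\<^esub> ?x k \<otimes>\<^bsub>G\<^esub> h)"
    by simp
qed

text \<open>Leaving \<open>n\<close> free above \<open>2 ^ k\<close> keeps the shorter witnesses in
  the same group, as the induction requires.\<close>

lemma cactus_witness_pow:
  "2 ^ k \<le> n \<Longrightarrow>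
    cactus_class n (cactus_witness k) [^]\<^bsub>cactus_group n\<^esub> (2 ^ k :: nat) = \<one>\<^bsub>cactus_group n\<^esub>"
proof (induction k)
  case 0
  interpret group "cactus_group n" by (rule group_cactus_group)
  show ?case using nat_pow_one[of "1"] by (simp add: cactus_class_one)
next
  case (Suc k)
  interpret group "cactus_group n" by (rule group_cactus_group)
  have k: "2 ^ k \<le> n" using Suc.prems by simp
  have "(1, 2 ^ Suc k) \<in> cactus_gens n"
    using cactus_gens_power[of "Suc k" "Suc k" n] Suc.prems by simp
  then have "cactus_class n (cactus_witness (Suc k)) =
      cactus_class n [cactus_s 1 (2 ^ Suc k)] \<otimes>\<^bsub>cactus_group n\<^esub> cactus_class n (cactus_witness k)"
    using cactus_witness_words[OF k] by (simp add: cactus_class_mult)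
  moreover note pow_double_of_involution[OF cactus_witness_mirror_commute(3,2)[OF Suc.prems]
      cactus_class_carrier[OF cactus_witness_words[OF k]]
      cactus_witness_mirror_commute(1)[OF Suc.prems] Suc.IH[OF k]]
  ultimately show ?case by simp
qed

theorem theorem4p4:
  fixes k :: nat
  assumes "k \<ge> 1"
  shows "\<exists>x \<in> carrier (cactus_group (2 ^ k)). group.ord (cactus_group (2 ^ k)) x = 2 ^ k"
proof -
  let ?n = "2 ^ k :: nat"
  interpret group "cactus_group ?n" by (rule group_cactus_group)
  let ?x = "cactus_class ?n (cactus_witness k)"
  obtain j where j: "k = Suc j" using assms by (cases k) auto
  have w: "cactus_witness k \<in> pres_words (cactus_gens ?n)"
    by (rule cactus_witness_words) simp
  have x: "?x \<in> carrier (cactus_group ?n)" by (rule cactus_class_carrier[OF w])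
  have "ord ?x dvd 2 ^ k"
    using cactus_witness_pow[of k ?n] pow_eq_id[OF x] by simp
  then obtain i where i: "i \<le> k" "ord ?x = 2 ^ i"
    using divides_primepow_nat[of 2 "ord ?x" k] by auto
  \<comment> \<open>Every proper divisor of \<open>2 ^ k\<close> divides \<open>2 ^ j\<close>, so
    excluding this one exponent pins down the order.\<close>
  have "\<not> ord ?x dvd 2 ^ j"
  proof
    assume "ord ?x dvd 2 ^ j"
    then have "?x [^]\<^bsub>cactus_group ?n\<^esub> (2 ^ j :: nat) = \<one>\<^bsub>cactus_group ?n\<^esub>"
      using pow_eq_id[OF x] by blast
    then have "cactus_act (cactus_witness k) ^^ (2 ^ j) = id"
      by (rule cactus_class_pow_act[OF w])
    then show False using cactus_witness_act_power_ne[of j] j by simp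
  qed
  then have "\<not> i \<le> j" using i(2) by (auto simp: le_imp_power_dvd)
  then have "i = k" using i(1) j by simp
  then show ?thesis using i(2) x by blast
qed

end
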